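(* For every integer $r\ge 1$, there exist locally checkable problems with the following round complexities in $n$-node graphs in the LOCAL model: (i) $\Theta\big(\log^{\star(r)} n\big)$; (ii) $\Theta\big(\log^{\epsilon}(\log^{\star(r)} n)\big)$, for every real $\epsilon\in(0,1)$; (iii) $\Theta\big(\log^{(k)}(\log^{\star(r)} n)\big)$, for every integer $k\ge 1$.
   Context: Notation. Logarithms are in base $2$; $\log^{\epsilon}x=(\log x)^{\epsilon}$; $\log^{(k)}$ is the $k$-th iterate of $\log$ ($\log^{(1)}=\log$, $\log^{(k)}=\log\circ\log^{(k-1)}$); $\log^\star n$ is the number of times $\log$ must be applied to $n$ until the result is at most $1$; $\log^{\star(r)} n=\log^\star(\cdots(\log^\star(n))\cdots)$ with $r$ successive applications of $\log^\star$. LOCAL model. The network is a simple connected graph $G=(V,E)$ with $n\ge 1$ nodes. Each node $v$ has an identifier $\mathrm{id}(v)\in[0,N]$, unique in the network, where $N$ is an upper bound on $n$ that is polynomial in $n$; $N$ may be given to the nodes. Initially a node knows only its identifier, its degree and its input label (and $N$), and nothing else about the graph. Computation proceeds in synchronous rounds, all nodes starting at the same round; in each round every node performs arbitrary local computation, sends a message of arbitrary size to each neighbor, and receives its neighbors' messages. Each node eventually outputs a label. The round complexity of a (deterministic) algorithm is the function of $n$ giving the maximum, over all $n$-node graphs (and all identifier and input assignments), of the number of rounds until all nodes have output. Locally checkable problem. A pair $(L,\varphi)$ where $L$ is a finite set of labels and $\varphi$ is a Boolean predicate on $L$-labeled balls of some fixed integer radius $\rho\ge 0$ in arbitrary graphs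 (no bound on the degrees); the ball of radius $\rho$ centered at $v$ is the subgraph induced by the nodes at distance at most $\rho$ from $v$. Input labels are allowed: $L=L_{in}\times L_{out}$, each node $v$ receives an arbitrary $\ell_{in}(v)\in L_{in}$ and must output $\ell_{out}(v)\in L_{out}$. An algorithm solves the problem if for every input graph and every input labeling the produced labeling is such that the labeled ball of radius $\rho$ around every node satisfies $\varphi$. A problem has round complexity $\Theta(t(n))$ if some algorithm solves it in $O(t(n))$ rounds and every algorithm solving it has round complexity $\Omega(t(n))$. *)

theory Defs
  imports Complex_Main "HOL-Library.Extended_Real"
begin

section \<open>Iterated logarithms\<close>

definition log_star :: "nat \<Rightarrow> nat" where
  "log_star n = (LEAST k. (log 2 ^^ k) (real n) \<le> 1)"


section \<open>Networks\<close>

text \<open>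
  Identifiers are unique, so a node is identified with its identifier. An edge is represented by
  both of its orientations. The list \<open>ports G v\<close> enumerates the neighbours of \<open>v\<close> in an arbitrary
  order; a node addresses its neighbours by their position in this list, so that it can send
  different messages to different neighbours without initially knowing anything about them but
  their number. The values of \<open>ports\<close> and \<open>inp\<close> outside of \<open>verts\<close> are irrelevant.
\<close>

record network =
  verts :: "nat set"
  edges :: "(nat \<times> nat) set"
  ports :: "nat \<Rightarrow> nat list"
  inp :: "nat \<Rightarrow> nat"

definition is_network :: "network \<Rightarrow> bool" where
  "is_network G \<longleftrightarrow>
     finite (verts G) \<and> verts G \<noteq> {} \<and>
     edges G \<subseteq> verts G \<times> verts G \<and> sym (edges G) \<and> irrefl (edges G) \<and>
     (\<forall>u\<in>verts G. \<forall>v\<in>verts G. (u, v) \<in> (edges G)\<^sup>*) \<and>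
     (\<forall>v\<in>verts G. distinct (ports G v) \<and> set (ports G v) = {u. (v, u) \<in> edges G})"

definition port_to :: "network \<Rightarrow> nat \<Rightarrow> nat \<Rightarrow> nat" where
  "port_to G u v = (THE i. i < length (ports G u) \<and> ports G u ! i = v)"


section \<open>Locally checkable problems\<close>

text \<open>A label is a pair of an input and an output label; finite label sets are coded as sets of
  natural numbers.\<close>

record labeled_ball =
  bverts :: "nat set"
  bedges :: "(nat \<times> nat) set"
  bcenter :: nat
  blabel :: "nat \<Rightarrow> nat \<times> nat"

definition ball_iso :: "labeled_ball \<Rightarrow> labeled_ball \<Rightarrow> bool" where
  "ball_iso B B' \<longleftrightarrow>
     (\<exists>f. bij_betw f (bverts B) (bverts B') \<and> f (bcenter B) = bcenter B' \<and>
          (\<forall>u\<in>bverts B. \<forall>v\<in>bverts B. (u, v) \<in> bedges B \<longleftrightarrow> (f u, f v) \<in> bedges B') \<and>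
          (\<forall>u\<in>bverts B. blabel B' (f u) = blabel B u))"

definition ball_verts :: "network \<Rightarrow> nat \<Rightarrow> nat \<Rightarrow> nat set" where
  "ball_verts G \<rho> v = {u. \<exists>k\<le>\<rho>. (v, u) \<in> edges G ^^ k}"

definition ball_at :: "network \<Rightarrow> (nat \<Rightarrow> nat) \<Rightarrow> nat \<Rightarrow> nat \<Rightarrow> labeled_ball" where
  "ball_at G outl \<rho> v =
     \<lparr>bverts = ball_verts G \<rho> v,
      bedges = edges G \<inter> (ball_verts G \<rho> v \<times> ball_verts G \<rho> v),
      bcenter = v,
      blabel = (\<lambda>u. (inp G u, outl u))\<rparr>"

record problem =
  in_labels :: "nat set"
  out_labels :: "nat set"
  radius :: nat
  good_ball :: "labeled_ball \<Rightarrow> bool"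

text \<open>Invariance under isomorphism expresses that the predicate sees the labeled graph only: in
  particular, it does not see the identifiers of the nodes.\<close>

definition locally_checkable :: "problem \<Rightarrow> bool" where
  "locally_checkable P \<longleftrightarrow>
     finite (in_labels P) \<and> finite (out_labels P) \<and>
     (\<forall>B B'. ball_iso B B' \<longrightarrow> good_ball P B = good_ball P B')"


section \<open>The LOCAL model\<close>

text \<open>
  States and messages are natural numbers. This is no restriction: only countably many states can
  be reached over all networks, so states and messages of any other type can be encoded.
  None of the functions is required to be computable.

  \<open>init N i d l\<close> is the initial state of a node with identifier \<open>i\<close>, degree \<open>d\<close> and input
  label \<open>l\<close>; \<open>send s p\<close> is the message sent through port \<open>p\<close>; \<open>receive\<close> takes the messages received
  in a round in the order of the ports; \<open>decide\<close> is \<open>None\<close> as long as there is no output.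
\<close>

record algorithm =
  init :: "nat \<Rightarrow> nat \<Rightarrow> nat \<Rightarrow> nat \<Rightarrow> nat"
  send :: "nat \<Rightarrow> nat \<Rightarrow> nat"
  receive :: "nat \<Rightarrow> nat list \<Rightarrow> nat"
  decide :: "nat \<Rightarrow> nat option"

primrec state_after :: "algorithm \<Rightarrow> nat \<Rightarrow> network \<Rightarrow> nat \<Rightarrow> nat \<Rightarrow> nat" where
  "state_after A N G 0 v = init A N v (length (ports G v)) (inp G v)"
| "state_after A N G (Suc t) v =
     receive A (state_after A N G t v)
       (map (\<lambda>u. send A (state_after A N G t u) (port_to G u v)) (ports G v))"

definition has_output :: "algorithm \<Rightarrow> nat \<Rightarrow> network \<Rightarrow> nat \<Rightarrow> nat \<Rightarrow> bool" where
  "has_output A N G v t \<longleftrightarrow> decide A (state_after A N G t v) \<noteq> None"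

text \<open>The first output of a node is its final one; the node may still communicate afterwards.\<close>

definition final_output :: "algorithm \<Rightarrow> nat \<Rightarrow> network \<Rightarrow> nat \<Rightarrow> nat" where
  "final_output A N G v = the (decide A (state_after A N G (LEAST t. has_output A N G v t) v))"

definition rounds :: "algorithm \<Rightarrow> nat \<Rightarrow> network \<Rightarrow> enat" where
  "rounds A N G = (SUP v\<in>verts G. INF t\<in>{t. has_output A N G v t}. enat t)"

text \<open>
  \<open>Ns n\<close> is the set of values of the bound \<open>N\<close> that may come with an \<open>n\<close>-node network. This covers
  both the case where \<open>N\<close> is a fixed function of \<open>n\<close> and the case where it is only known to lie
  between \<open>n\<close> and some polynomial in \<open>n\<close>.
\<close>

definition polynomial_bounds :: "(nat \<Rightarrow> nat set) \<Rightarrow> bool" where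
  "polynomial_bounds Ns \<longleftrightarrow> (\<exists>c. \<forall>n\<ge>1. Ns n \<noteq> {} \<and> Ns n \<subseteq> {n..c * n ^ c})"

definition instances :: "problem \<Rightarrow> (nat \<Rightarrow> nat set) \<Rightarrow> nat \<Rightarrow> (nat \<times> network) set" where
  "instances P Ns n =
     {(N, G). is_network G \<and> card (verts G) = n \<and> N \<in> Ns n \<and> verts G \<subseteq> {0..N} \<and>
              (\<forall>v\<in>verts G. inp G v \<in> in_labels P)}"

definition solves :: "(nat \<Rightarrow> nat set) \<Rightarrow> algorithm \<Rightarrow> problem \<Rightarrow> bool" where
  "solves Ns A P \<longleftrightarrow>
     (\<forall>n\<ge>1. \<forall>(N, G)\<in>instances P Ns n. \<forall>v\<in>verts G.
        (\<exists>t. has_output A N G v t) \<and>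
        final_output A N G v \<in> out_labels P \<and>
        good_ball P (ball_at G (final_output A N G) (radius P) v))"

definition round_complexity :: "(nat \<Rightarrow> nat set) \<Rightarrow> algorithm \<Rightarrow> problem \<Rightarrow> nat \<Rightarrow> enat" where
  "round_complexity Ns A P n = (SUP (N, G)\<in>instances P Ns n. rounds A N G)"

definition problem_complexity_Theta :: "problem \<Rightarrow> (nat \<Rightarrow> real) \<Rightarrow> bool" where
  "problem_complexity_Theta P t \<longleftrightarrow>
     (\<forall>Ns. polynomial_bounds Ns \<longrightarrow>
        (\<exists>A. solves Ns A P \<and>
           (\<exists>c::real>0. \<forall>\<^sub>F n in sequentially.
              ereal_of_enat (round_complexity Ns A P n) \<le> ereal (c * t n))) \<and>
        (\<forall>A. solves Ns A P \<longrightarrow>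
           (\<exists>c::real>0. \<forall>\<^sub>F n in sequentially.
              ereal (c * t n) \<le> ereal_of_enat (round_complexity Ns A P n))))"

end

theory Submission
  imports Defs
begin

text \<open>
  Fix a monotone unbounded rank function \<open>T\<close> with \<open>T (2 ^ n) \<le> T n + 1\<close>, and let the predecessors of
  a node \<open>v\<close> be its neighbours whose degree has rank one less than the degree of \<open>v\<close>. In the relay
  problem the input of a node fixes its output bit to \<open>0\<close> or \<open>1\<close>, or (input \<open>2\<close>) asks for the
  disjunction of the outputs of its predecessors. A chain of predecessors has at most \<open>T n\<close> edges,
  so \<open>T n\<close> rounds suffice. Conversely, a path whose nodes carry enough leaves to have degrees of
  rank \<open>0, 1, 2, \<dots>\<close> fits into \<open>n\<close> nodes up to rank \<open>T n - O(1)\<close>, because the least number of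
  rank \<open>i + 1\<close> is about exponential in that of rank \<open>i\<close>; on it a bit has to travel along the whole
  path. The functions of the theorem are, up to rounding, such rank functions.
\<close>

section \<open>The relay problem\<close>

definition bdeg :: "labeled_ball \<Rightarrow> nat \<Rightarrow> nat" where
  "bdeg B u = card {w \<in> bverts B. (u, w) \<in> bedges B}"

definition bcentral :: "labeled_ball \<Rightarrow> nat \<Rightarrow> bool" where
  "bcentral B c \<longleftrightarrow> c \<in> bverts B \<and>
     (\<forall>u\<in>bverts B. c = u \<or> (c, u) \<in> bedges B \<or>
        (\<exists>w\<in>bverts B. (c, w) \<in> bedges B \<and> (w, u) \<in> bedges B))"

definition relay_rule :: "(nat \<Rightarrow> nat) \<Rightarrow> labeled_ball \<Rightarrow> nat \<Rightarrow> bool" where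
  "relay_rule T B c \<longleftrightarrow>
     (snd (blabel B c) = 1 \<longleftrightarrow>
        fst (blabel B c) = 1 \<or>
        fst (blabel B c) = 2 \<and>
          (\<exists>u\<in>bverts B. (c, u) \<in> bedges B \<and> Suc (T (bdeg B u)) = T (bdeg B c) \<and>
             snd (blabel B u) = 1))"

text \<open>The relation \<open>ball_iso\<close> does not exclude a centre that lies outside of the ball, and such a centre
  may be mapped to any node. A predicate that respects \<open>ball_iso\<close> therefore cannot depend on
  \<open>bcenter\<close>, so the rule is imposed only if the centre can be recovered as the unique node of
  eccentricity at most \<open>2\<close>. On the path of the lower bound this is always the case.\<close>

definition relay_good :: "(nat \<Rightarrow> nat) \<Rightarrow> labeled_ball \<Rightarrow> bool" where
  "relay_good T B \<longleftrightarrow>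
     (\<forall>c. bcentral B c \<and> (\<forall>c'. bcentral B c' \<longrightarrow> c' = c) \<longrightarrow> relay_rule T B c)"

definition relay :: "(nat \<Rightarrow> nat) \<Rightarrow> problem" where
  "relay T = \<lparr>in_labels = {0, 1, 2}, out_labels = {0, 1}, radius = 2, good_ball = relay_good T\<rparr>"

text \<open>Nothing is assumed about \<open>bcenter\<close>, since \<open>relay_good\<close>
  recovers the centre from the graph. The map \<open>f\<close> preserves degrees, eccentricities and
  labels, hence also which nodes are central and whether the rule holds at them.\<close>

lemma relay_good_iso:
  assumes f: "bij_betw f (bverts B) (bverts B')"
    and e: "\<And>u v. u \<in> bverts B \<Longrightarrow> v \<in> bverts B \<Longrightarrow> (f u, f v) \<in> bedges B' \<longleftrightarrow> (u, v) \<in> bedges B"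
    and l: "\<And>u. u \<in> bverts B \<Longrightarrow> blabel B' (f u) = blabel B u"
  shows "relay_good T B' \<longleftrightarrow> relay_good T B"
proof -
  let ?V = "bverts B"
  have V': "bverts B' = f ` ?V" using f by (simp add: bij_betw_def)
  have inj: "inj_on f ?V" using f by (simp add: bij_betw_def)
  have deg: "bdeg B' (f u) = bdeg B u" if "u \<in> ?V" for u
  proof -
    have "{w \<in> bverts B'. (f u, w) \<in> bedges B'} = f ` {w \<in> ?V. (u, w) \<in> bedges B}"
      using e that by (auto simp: V')
    moreover have "inj_on f {w \<in> ?V. (u, w) \<in> bedges B}"
      using inj by (rule inj_on_subset) auto
    ultimately show ?thesis by (simp add: bdeg_def card_image)
  qed
  have cen: "bcentral B' (f c) \<longleftrightarrow> bcentral B c" if "c \<in> ?V" for c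
    using that by (simp add: bcentral_def V' e inj_on_eq_iff[OF inj])
  have rule: "relay_rule T B' (f c) \<longleftrightarrow> relay_rule T B c" if "c \<in> ?V" for c
    using that by (simp add: relay_rule_def V' e l deg)
  have cV: "bcentral B c \<Longrightarrow> c \<in> ?V" "bcentral B' c \<Longrightarrow> c \<in> f ` ?V" for c
    by (simp_all add: bcentral_def V')
  have eq: "f c = f c' \<longleftrightarrow> c = c'" if "c \<in> ?V" "c' \<in> ?V" for c c'
    using that inj by (simp add: inj_on_eq_iff)
  show ?thesis
  proof
    assume g: "relay_good T B'"
    show "relay_good T B"
      unfolding relay_good_def
    proof (intro allI impI, elim conjE)
      fix c assume c: "bcentral B c" and u: "\<forall>c'. bcentral B c' \<longrightarrow> c' = c"
      have cV': "c \<in> ?V" using c by (rule cV)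
      \<comment> \<open>Uniqueness ranges over all naturals, but a central node lies in the ball and
        thus has a preimage under \<open>f\<close>.\<close>
      have "d = f c" if d: "bcentral B' d" for d
      proof -
        obtain c' where c': "c' \<in> ?V" "d = f c'" using cV(2)[OF d] by blast
        then have "bcentral B c'" using d cen by blast
        then show ?thesis using u c' by blast
      qed
      moreover have "bcentral B' (f c)" using c cV' cen by blast
      ultimately have "relay_rule T B' (f c)" using g unfolding relay_good_def by blast
      then show "relay_rule T B c" using rule cV' by blast
    qed
  next
    assume g: "relay_good T B"
    show "relay_good T B'"
      unfolding relay_good_def
    proof (intro allI impI, elim conjE)
      fix d assume d: "bcentral B' d" and u: "\<forall>c'. bcentral B' c' \<longrightarrow> c' = d"
      obtain c where c: "c \<in> ?V" "d = f c" using cV(2)[OF d] by blast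
      have "c' = c" if c': "bcentral B c'" for c'
      proof -
        have "c' \<in> ?V" using c' by (rule cV)
        moreover from this have "f c' = d" using c' cen u by blast
        ultimately show ?thesis using c eq by blast
      qed
      moreover have "bcentral B c" using c d cen by blast
      ultimately have "relay_rule T B c" using g unfolding relay_good_def by blast
      then show "relay_rule T B' d" using rule c by blast
    qed
  qed
qed

lemma locally_checkable_relay: "locally_checkable (relay T)"
  unfolding locally_checkable_def ball_iso_def
proof (intro conjI allI impI)
  fix B B' :: labeled_ball
  assume "\<exists>f. bij_betw f (bverts B) (bverts B') \<and> f (bcenter B) = bcenter B' \<and>
          (\<forall>u\<in>bverts B. \<forall>v\<in>bverts B. (u, v) \<in> bedges B \<longleftrightarrow> (f u, f v) \<in> bedges B') \<and>
          (\<forall>u\<in>bverts B. blabel B' (f u) = blabel B u)"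
  then show "good_ball (relay T) B = good_ball (relay T) B'"
    using relay_good_iso[of _ B B' T] by (fastforce simp: relay_def)
qed (simp_all add: relay_def)

section \<open>Balls of radius 2 in a network\<close>

lemma ball_verts_2:
  "ball_verts G 2 v = {u. u = v \<or> (v, u) \<in> edges G \<or> (\<exists>w. (v, w) \<in> edges G \<and> (w, u) \<in> edges G)}"
proof -
  have "{..2::nat} = {0, 1, 2}" by auto
  then have "(\<exists>k\<le>2. P k) \<longleftrightarrow> P 0 \<or> P 1 \<or> P (2::nat)" for P
    by (metis atMost_iff insert_iff singletonD)
  then show ?thesis by (auto simp: ball_verts_def numeral_2_eq_2)
qed

lemma bcentral_ball_at: "bcentral (ball_at G out 2 v) v"
  by (auto simp: bcentral_def ball_at_def ball_verts_2)

text \<open>All neighbours of \<open>u\<close> are within distance 2 of \<open>v\<close>. The rule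
  at \<open>v\<close> needs the true degrees of the neighbours of \<open>v\<close>, hence the radius
  2 in \<open>relay\<close>.\<close>

lemma bdeg_ball_at:
  assumes "u = v \<or> (v, u) \<in> edges G"
  shows "bdeg (ball_at G out 2 v) u = card {w. (u, w) \<in> edges G}"
proof -
  have "{w \<in> ball_verts G 2 v. (u, w) \<in> edges G \<inter> ball_verts G 2 v \<times> ball_verts G 2 v}
      = {w. (u, w) \<in> edges G}"
    using assms by (auto simp: ball_verts_2)
  then show ?thesis by (simp add: bdeg_def ball_at_def)
qed

definition deg :: "network \<Rightarrow> nat \<Rightarrow> nat" where
  "deg G v = card {w. (v, w) \<in> edges G}"

lemma relay_rule_ball_at:
  "relay_rule T (ball_at G out 2 v) v \<longleftrightarrow>
     (out v = 1 \<longleftrightarrow> inp G v = 1 \<or> inp G v = 2 \<and>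
        (\<exists>u. (v, u) \<in> edges G \<and> Suc (T (deg G u)) = T (deg G v) \<and> out u = 1))"
proof -
  have "bdeg (ball_at G out 2 v) v = deg G v"
    by (simp add: bdeg_ball_at deg_def)
  moreover have "(\<exists>u\<in>ball_verts G 2 v. (v, u) \<in> edges G \<inter> ball_verts G 2 v \<times> ball_verts G 2 v \<and>
        Suc (T (bdeg (ball_at G out 2 v) u)) = T (deg G v) \<and> out u = 1) \<longleftrightarrow>
      (\<exists>u. (v, u) \<in> edges G \<and> Suc (T (deg G u)) = T (deg G v) \<and> out u = 1)"
    by (rule iffI; elim bexE exE; intro exI bexI) (auto simp: bdeg_ball_at deg_def ball_verts_2)
  ultimately show ?thesis
    by (simp add: relay_rule_def) (simp add: ball_at_def)
qed

text \<open>As \<open>v\<close> is always central in its own ball, a unique central node can only be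
  \<open>v\<close>.\<close>

lemma relay_goodI:
  assumes "relay_rule T (ball_at G out 2 v) v"
  shows "relay_good T (ball_at G out 2 v)"
  unfolding relay_good_def
proof (intro allI impI, elim conjE)
  fix c assume "\<forall>c'. bcentral (ball_at G out 2 v) c' \<longrightarrow> c' = c"
  then have "v = c" using bcentral_ball_at by blast
  with assms show "relay_rule T (ball_at G out 2 v) c" by simp
qed

section \<open>The relay algorithm\<close>

text \<open>States must be single naturals, so degree, input label, number of elapsed rounds and
  current bit are packed by pairing.\<close>

definition enc :: "nat \<Rightarrow> nat \<Rightarrow> nat \<Rightarrow> nat \<Rightarrow> nat" where
  "enc d l t x = prod_encode (prod_encode (d, l), prod_encode (t, x))"

definition st_deg :: "nat \<Rightarrow> nat" where "st_deg s = fst (prod_decode (fst (prod_decode s)))"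
definition st_inp :: "nat \<Rightarrow> nat" where "st_inp s = snd (prod_decode (fst (prod_decode s)))"
definition st_time :: "nat \<Rightarrow> nat" where "st_time s = fst (prod_decode (snd (prod_decode s)))"
definition st_val :: "nat \<Rightarrow> nat" where "st_val s = snd (prod_decode (snd (prod_decode s)))"

lemma st_enc [simp]:
  "st_deg (enc d l t x) = d" "st_inp (enc d l t x) = l"
  "st_time (enc d l t x) = t" "st_val (enc d l t x) = x"
  by (simp_all add: enc_def st_deg_def st_inp_def st_time_def st_val_def)

text \<open>The message is the whole state, so neighbours learn degree and bit. The degree alone
  tells a node its rank, and the rank is the round in which it decides.\<close>

definition relay_alg :: "(nat \<Rightarrow> nat) \<Rightarrow> algorithm" where
  "relay_alg T = \<lparr>
     init = (\<lambda>N i d l. enc d l 0 (if l = 1 then 1 else 0)),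
     send = (\<lambda>s p. s),
     receive = (\<lambda>s ms. enc (st_deg s) (st_inp s) (Suc (st_time s))
       (if st_inp s = 1 \<or> st_inp s = 2 \<and>
          (\<exists>m\<in>set ms. Suc (T (st_deg m)) = T (st_deg s) \<and> st_val m = 1) then 1 else 0)),
     decide = (\<lambda>s. if T (st_deg s) \<le> st_time s then Some (st_val s) else None)\<rparr>"

lemma relay_alg_sel:
  "init (relay_alg T) N i d l = enc d l 0 (if l = 1 then 1 else 0)"
  "send (relay_alg T) s p = s"
  "receive (relay_alg T) s ms = enc (st_deg s) (st_inp s) (Suc (st_time s))
     (if st_inp s = 1 \<or> st_inp s = 2 \<and>
        (\<exists>m\<in>set ms. Suc (T (st_deg m)) = T (st_deg s) \<and> st_val m = 1) then 1 else 0)"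
  "decide (relay_alg T) s = (if T (st_deg s) \<le> st_time s then Some (st_val s) else None)"
  by (simp_all add: relay_alg_def)

lemma is_network_deg:
  assumes "is_network G" "v \<in> verts G"
  shows "length (ports G v) = deg G v" "set (ports G v) = {u. (v, u) \<in> edges G}"
  using assms by (auto simp: is_network_def deg_def distinct_card[symmetric])

lemma deg_less_card:
  assumes "is_network G" "v \<in> verts G"
  shows "deg G v < card (verts G)"
proof -
  have "{w. (v, w) \<in> edges G} \<subseteq> verts G - {v}"
    using assms by (auto simp: is_network_def irrefl_def)
  moreover have "finite (verts G)" using assms by (simp add: is_network_def)
  ultimately have "deg G v \<le> card (verts G - {v})"
    unfolding deg_def by (intro card_mono) auto
  also have "\<dots> < card (verts G)"
    using assms \<open>finite (verts G)\<close> by (intro psubset_card_mono) auto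
  finally show ?thesis .
qed

section \<open>Runs of the relay algorithm\<close>

context
  fixes T :: "nat \<Rightarrow> nat" and N :: nat and G :: network
  assumes G: "is_network G"
begin

definition relay_val :: "nat \<Rightarrow> nat \<Rightarrow> nat" where
  "relay_val t v = st_val (state_after (relay_alg T) N G t v)"

lemma state_after_relay:
  assumes "v \<in> verts G"
  shows "state_after (relay_alg T) N G t v = enc (deg G v) (inp G v) t (relay_val t v)"
proof -
  have "\<exists>x. state_after (relay_alg T) N G t v = enc (deg G v) (inp G v) t x"
  proof (induction t)
    case 0
    show ?case 
      unfolding state_after.simps relay_alg_sel is_network_deg(1)[OF G assms] by blast
  next
    case (Suc t)
    then obtain x where x: "state_after (relay_alg T) N G t v = enc (deg G v) (inp G v) t x" ..
    show ?case
      unfolding state_after.simps x relay_alg_sel st_enc by blast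
  qed
  then show ?thesis by (auto simp: relay_val_def)
qed

lemma relay_val_0: "relay_val 0 v = (if inp G v = 1 then 1 else 0)"
  by (simp add: relay_val_def relay_alg_sel)

lemma relay_val_Suc:
  assumes v: "v \<in> verts G"
  shows "relay_val (Suc t) v = (if inp G v = 1 \<or> inp G v = 2 \<and>
     (\<exists>u. (v, u) \<in> edges G \<and> Suc (T (deg G u)) = T (deg G v) \<and> relay_val t u = 1) then 1 else 0)"
proof -
  have *: "u \<in> verts G" if "(v, u) \<in> edges G" for u
    using that G by (auto simp: is_network_def)
  have "relay_val (Suc t) v = st_val (receive (relay_alg T) (enc (deg G v) (inp G v) t (relay_val t v))
      (map (\<lambda>u. enc (deg G u) (inp G u) t (relay_val t u)) (ports G v)))"
    unfolding relay_val_def[of "Suc t"] state_after.simps relay_alg_sel(2)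
    using * v is_network_deg(2)[OF G v]
    by (intro arg_cong[where f = st_val] arg_cong2[where f = "receive (relay_alg T)"] map_cong)
      (auto simp: state_after_relay)
  also have "\<dots> = (if inp G v = 1 \<or> inp G v = 2 \<and>
     (\<exists>u. (v, u) \<in> edges G \<and> Suc (T (deg G u)) = T (deg G v) \<and> relay_val t u = 1) then 1 else 0)"
    using is_network_deg(2)[OF G v] by (simp add: relay_alg_sel)
  finally show ?thesis .
qed

text \<open>A node of rank 0 has no predecessors, and a bit at rank \<open>k + 1\<close> depends
  only on bits at rank \<open>k\<close> one round earlier. By induction, a bit settles after as many
  rounds as its rank.\<close>

lemma relay_val_stable:
  "v \<in> verts G \<Longrightarrow> T (deg G v) \<le> t \<Longrightarrow> relay_val t v = relay_val (T (deg G v)) v"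
proof (induction "T (deg G v)" arbitrary: v t rule: less_induct)
  case less
  show ?case
  proof (cases "T (deg G v)")
    case 0
    then show ?thesis
      using less.prems by (cases t) (simp_all add: relay_val_0 relay_val_Suc)
  next
    case (Suc k)
    then obtain t' where t': "t = Suc t'" "k \<le> t'"
      using less.prems by (cases t) auto
    have "relay_val t' u = relay_val k u" if "(v, u) \<in> edges G" "Suc (T (deg G u)) = Suc k" for u
    proof -
      have "u \<in> verts G" using that G by (auto simp: is_network_def)
      then show ?thesis
        using less.hyps[of u t'] that t' Suc by simp
    qed
    then show ?thesis
      using less.prems Suc by (auto simp: t' relay_val_Suc)
  qed
qed

definition relay_out :: "nat \<Rightarrow> nat" where
  "relay_out v = relay_val (T (deg G v)) v"

text \<open>Nodes decide at different times, but a predecessor has rank exactly one less. So the bit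
  that \<open>v\<close> reads in its deciding round is the one that the predecessor outputs.\<close>

lemma relay_out_rule:
  assumes v: "v \<in> verts G"
  shows "relay_out v = 1 \<longleftrightarrow> inp G v = 1 \<or> inp G v = 2 \<and>
     (\<exists>u. (v, u) \<in> edges G \<and> Suc (T (deg G u)) = T (deg G v) \<and> relay_out u = 1)"
proof (cases "T (deg G v)")
  case 0
  then show ?thesis by (simp add: relay_out_def relay_val_0)
next
  case (Suc k)
  then show ?thesis
    by (auto simp: relay_out_def relay_val_Suc[OF v])
qed

lemma has_output_relay:
  assumes "v \<in> verts G"
  shows "has_output (relay_alg T) N G v t \<longleftrightarrow> T (deg G v) \<le> t"
  unfolding has_output_def state_after_relay[OF assms] by (simp add: relay_alg_sel)

lemma final_output_relay:
  assumes "v \<in> verts G"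
  shows "final_output (relay_alg T) N G v = relay_out v"
proof -
  have "(LEAST t. has_output (relay_alg T) N G v t) = T (deg G v)"
    using assms by (intro Least_equality) (simp_all add: has_output_relay)
  then show ?thesis
    unfolding final_output_def using assms
    by (simp add: state_after_relay relay_out_def relay_alg_sel)
qed

lemma relay_out_bit: "v \<in> verts G \<Longrightarrow> relay_out v \<in> {0, 1}"
  by (cases "T (deg G v)") (simp_all add: relay_out_def relay_val_0 relay_val_Suc)

lemma relay_good_final:
  assumes v: "v \<in> verts G"
  shows "relay_good T (ball_at G (final_output (relay_alg T) N G) 2 v)"
proof -
  have "(final_output (relay_alg T) N G v = 1 \<longleftrightarrow> inp G v = 1 \<or> inp G v = 2 \<and>
        (\<exists>u. (v, u) \<in> edges G \<and> Suc (T (deg G u)) = T (deg G v) \<and>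
           final_output (relay_alg T) N G u = 1))"
  proof -
    have "(v, u) \<in> edges G \<Longrightarrow> final_output (relay_alg T) N G u = relay_out u" for u
      using G by (intro final_output_relay) (auto simp: is_network_def)
    then show ?thesis
      using v relay_out_rule[OF v] by (auto simp: final_output_relay)
  qed
  then have "relay_rule T (ball_at G (final_output (relay_alg T) N G) 2 v) v"
    by (simp only: relay_rule_ball_at)
  then show ?thesis
    by (rule relay_goodI)
qed

lemma rounds_relay:
  assumes "mono T"
  shows "rounds (relay_alg T) N G \<le> enat (T (card (verts G)))"
  unfolding rounds_def
proof (rule SUP_least)
  fix v assume v: "v \<in> verts G"
  have "(INF t\<in>{t. has_output (relay_alg T) N G v t}. enat t) \<le> enat (T (deg G v))"
    using v by (intro INF_lower) (simp add: has_output_relay)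
  also have "\<dots> \<le> enat (T (card (verts G)))"
    using deg_less_card[OF G v] assms by (simp add: mono_def)
  finally show "(INF t\<in>{t. has_output (relay_alg T) N G v t}. enat t) \<le> enat (T (card (verts G)))" .
qed

end

lemma solves_relay: "solves Ns (relay_alg T) (relay T)"
  unfolding solves_def
proof (clarify, intro conjI)
  fix n N G v
  assume "(N, G) \<in> instances (relay T) Ns n" and v: "v \<in> verts G"
  then have G: "is_network G" by (simp add: instances_def)
  show "\<exists>t. has_output (relay_alg T) N G v t"
    using has_output_relay[OF G v] by blast
  show "final_output (relay_alg T) N G v \<in> out_labels (relay T)"
    using relay_out_bit[OF G v] by (simp add: final_output_relay[OF G v] relay_def)
  show "good_ball (relay T) (ball_at G (final_output (relay_alg T) N G) (radius (relay T)) v)"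
    using relay_good_final[OF G v] by (simp add: relay_def)
qed

lemma round_complexity_relay:
  assumes "mono T"
  shows "round_complexity Ns (relay_alg T) P n \<le> enat (T n)"
  unfolding round_complexity_def
  by (rule SUP_least) (auto simp: instances_def intro: rounds_relay[OF _ assms])

section \<open>Caterpillars\<close>

text \<open>\<open>T 3 = 0\<close> gives leaves rank 0 and makes every positive threshold at least
  4. \<open>T_exp\<close> spreads the ranks exponentially.\<close>

locale slow_rank =
  fixes T :: "nat \<Rightarrow> nat"
  assumes mono: "mono T" and T_3: "T 3 = 0"
    and T_exp: "T (2 ^ n) \<le> Suc (T n)"
    and T_unbounded: "\<exists>n. k \<le> T n"
begin

text \<open>This is the lower adjoint of \<open>T\<close>, see \<open>D_le_iff\<close>.\<close>

definition D :: "nat \<Rightarrow> nat" where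
  "D i = (LEAST d. i \<le> T d)"

lemma T_le: "m \<le> n \<Longrightarrow> T m \<le> T n"
  using mono by (simp add: mono_def)

text \<open>Since \<open>n + 1\<close> is at most \<open>2 ^ n\<close>, \<open>T\<close> skips no
  value. This makes \<open>T (D i)\<close> equal to \<open>i\<close> and not just at least
  \<open>i\<close>.\<close>

lemma T_Suc: "T (Suc n) \<le> Suc (T n)"
proof -
  have "Suc n \<le> 2 ^ n" by (simp add: Suc_le_eq)
  then show ?thesis using T_le T_exp order_trans by blast
qed

lemma D_le_iff: "D i \<le> n \<longleftrightarrow> i \<le> T n"
proof
  assume "D i \<le> n"
  moreover have "i \<le> T (D i)"
    unfolding D_def using T_unbounded by (rule LeastI_ex)
  ultimately show "i \<le> T n" using T_le order_trans by blast
next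
  assume "i \<le> T n"
  then show "D i \<le> n" unfolding D_def by (rule Least_le)
qed

lemma less_D_iff: "n < D i \<longleftrightarrow> T n < i"
  using D_le_iff[of i n] by linarith

lemma D_0: "D 0 = 0"
  using D_le_iff[of 0 0] by simp

lemma D_ge_4: "0 < i \<Longrightarrow> 4 \<le> D i"
  using less_D_iff[of 3 i] T_3 by simp

lemma T_D: "T (D i) = i"
proof (cases "D i")
  case 0
  then show ?thesis using D_le_iff[of i 0] T_le[of 0 3] T_3 by simp
next
  case (Suc d)
  then have "T d < i" using less_D_iff[of d i] by simp
  moreover have "i \<le> T (D i)" using D_le_iff[of i "D i"] by simp
  ultimately show ?thesis using T_Suc[of d] Suc by simp
qed

lemma D_eq_iff: "D i = D j \<longleftrightarrow> i = j"
  by (metis T_D)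

lemma D_less_iff: "D i < D j \<longleftrightarrow> i < j"
  by (simp add: less_D_iff T_D)

text \<open>Layer \<open>i\<close> has to be large enough for its centre to reach degree
  \<open>D i\<close>; see \<open>deg_caterpillar\<close>.\<close>

lemma D_Suc_ge:
  assumes "0 < i"
  shows "2 * D i \<le> D (Suc i) + 1"
proof -
  obtain d where d: "D i = d + 4" using D_ge_4[OF assms] le_Suc_ex by (metis add.commute)
  \<comment> \<open>The number \<open>d + 3\<close> is \<open>D i - 1\<close>, the largest one of
    rank below \<open>i\<close>, so its exponential still has rank at most \<open>i\<close>.\<close>
  have "T (2 ^ (d + 3)) \<le> Suc (T (d + 3))" by (rule T_exp)
  also have "T (d + 3) < i" using less_D_iff[of "d + 3" i] d by simp
  finally have "2 ^ (d + 3) < D (Suc i)" by (simp add: less_D_iff)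
  moreover have "d + 1 \<le> 2 ^ d" by (simp add: Suc_le_eq)
  moreover have "(2::nat) ^ (d + 3) = 8 * 2 ^ d" by (simp add: power_add)
  ultimately show ?thesis using d by simp
qed

text \<open>The layer of rank \<open>i\<close> is a star with centre \<open>D i\<close>, and the centres form a path. The centre
  \<open>D i\<close> has degree about \<open>D (Suc i)\<close>, but less than that, so its degree has rank \<open>i\<close> again.\<close>

definition adj :: "nat \<Rightarrow> nat \<Rightarrow> bool" where
  "adj u v \<longleftrightarrow> u \<noteq> v \<and>
     (T u = T v \<and> (u = D (T u) \<or> v = D (T v)) \<or>
      u = D (T u) \<and> v = D (T v) \<and> (T u = Suc (T v) \<or> T v = Suc (T u)))"

text \<open>Node \<open>v\<close> lies in layer \<open>T v\<close>, so any \<open>n\<close> is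
  allowed: it merely truncates the last layer. The bit starts at \<open>D 2\<close> because the
  first centre with two centres below it, as \<open>bcentral_caterpillar\<close> needs, is
  \<open>D 2\<close>.\<close>

definition caterpillar :: "nat \<Rightarrow> nat \<Rightarrow> network" where
  "caterpillar n b =
     \<lparr>verts = {..<n}, edges = {(u, v). u < n \<and> v < n \<and> adj u v},
      ports = (\<lambda>v. sorted_list_of_set {u. v < n \<and> u < n \<and> adj v u}),
      inp = (\<lambda>v. if v = D 2 then b else 2)\<rparr>"

lemma adj_sym: "adj u v \<longleftrightarrow> adj v u"
  by (auto simp: adj_def)

lemma adj_T: "adj u v \<Longrightarrow> T u \<le> Suc (T v)"
  by (auto simp: adj_def)

lemma caterpillar_edges: "(u, v) \<in> edges (caterpillar n b) \<longleftrightarrow> u < n \<and> v < n \<and> adj u v"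
  by (simp add: caterpillar_def)

lemma caterpillar_set_ports: "set (ports (caterpillar n b) v) = {u. v < n \<and> u < n \<and> adj v u}"
  by (simp add: caterpillar_def)

text \<open>Step to the centre of the layer, then descend along the path of centres to
  \<open>D 0 = 0\<close>.\<close>

lemma caterpillar_connected:
  assumes "v < n"
  shows "(v, 0) \<in> (edges (caterpillar n b))\<^sup>*"
  using assms
proof (induction "T v" arbitrary: v rule: less_induct)
  case less
  have Dv: "D (T v) \<le> v" by (simp add: D_le_iff)
  have 1: "(v, D (T v)) \<in> (edges (caterpillar n b))\<^sup>*"
  proof (cases "v = D (T v)")
    case False
    then have "adj v (D (T v))" by (simp add: adj_def T_D)
    then show ?thesis using less.prems Dv by (intro r_into_rtrancl) (simp add: caterpillar_edges)
  qed simp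
  have 2: "(D (T v), 0) \<in> (edges (caterpillar n b))\<^sup>*"
  proof (cases "T v")
    case 0
    then show ?thesis by (simp add: D_0)
  next
    case (Suc i)
    then have *: "D i < D (T v)" by (simp add: D_less_iff)
    then have "(D i, 0) \<in> (edges (caterpillar n b))\<^sup>*"
      using less.hyps[of "D i"] less.prems Dv Suc by (simp add: T_D)
    moreover have "adj (D (T v)) (D i)"
      using * Suc by (simp add: adj_def T_D)
    then have "(D (T v), D i) \<in> edges (caterpillar n b)"
      using * less.prems Dv by (simp add: caterpillar_edges)
    ultimately show ?thesis by (meson converse_rtrancl_into_rtrancl)
  qed
  from 1 2 show ?case by (rule rtrancl_trans)
qed

lemma is_network_caterpillar:
  assumes "0 < n"
  shows "is_network (caterpillar n b)"
proof -
  let ?E = "edges (caterpillar n b)"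
  have sym: "sym ?E" using adj_sym by (auto simp: sym_def caterpillar_edges)
  have "(u, v) \<in> ?E\<^sup>*" if "u < n" "v < n" for u v
  proof -
    have "(0, v) \<in> ?E\<^sup>*"
      using caterpillar_connected[OF that(2)] sym_rtrancl[OF sym] by (blast dest: symD)
    then show ?thesis using caterpillar_connected[OF that(1)] by (meson rtrancl_trans)
  qed
  then have "\<forall>u\<in>{..<n}. \<forall>v\<in>{..<n}. (u, v) \<in> ?E\<^sup>*" by blast
  moreover have "irrefl ?E" by (auto simp: irrefl_def caterpillar_edges adj_def)
  moreover have "verts (caterpillar n b) = {..<n}" by (simp add: caterpillar_def)
  moreover have "?E \<subseteq> {..<n} \<times> {..<n}" by (auto simp: caterpillar_edges)
  moreover have "\<forall>v<n. distinct (ports (caterpillar n b) v) \<and>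
      set (ports (caterpillar n b) v) = {u. (v, u) \<in> ?E}"
    by (auto simp: caterpillar_set_ports caterpillar_edges) (simp add: caterpillar_def)
  ultimately show ?thesis
    using assms sym unfolding is_network_def by auto
qed

text \<open>The neighbours of \<open>D i\<close> are the previous centre, its leaves and the next
  centre. The bound on \<open>i\<close> ensures that layer \<open>i\<close> is complete and the next
  centre is present.\<close>

lemma deg_caterpillar:
  assumes i: "0 < i" and n: "Suc i \<le> T (n - 1)" "0 < n"
  shows "T (deg (caterpillar n b) (D i)) = i"
proof -
  have Dn: "D (Suc i) < n" using n D_le_iff[of "Suc i" "n - 1"] by linarith
  have less: "D (i - 1) < D i" "D i < D (Suc i)" using i by (simp_all add: D_less_iff)
  have "{w. (D i, w) \<in> edges (caterpillar n b)} = insert (D (i - 1)) {D i<..D (Suc i)}" (is "?A = ?B")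
  proof (intro set_eqI iffI)
    fix w assume "w \<in> ?A"
    then consider "w \<noteq> D i" "T w = i" | "w = D (Suc i)" | "w = D (i - 1)"
      by (auto simp: caterpillar_edges adj_def T_D)
    then show "w \<in> ?B"
    proof cases
      case 1
      then show ?thesis using D_le_iff[of i w] less_D_iff[of w "Suc i"] by simp
    qed (use less in auto)
  next
    fix w assume "w \<in> ?B"
    then consider "w = D (i - 1)" | "w = D (Suc i)" | "D i < w" "w < D (Suc i)"
      by fastforce
    then show "w \<in> ?A"
    proof cases
      case 3
      then have "T w = i" using D_le_iff[of i w] less_D_iff[of w "Suc i"] by simp
      then show ?thesis using 3 Dn by (simp add: caterpillar_edges adj_def T_D)
    qed (use less Dn i in \<open>auto simp: caterpillar_edges adj_def T_D\<close>)
  qed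
  then have deg: "deg (caterpillar n b) (D i) = D (Suc i) - D i + 1"
    using less by (simp add: deg_def)
  have "D i \<le> D (Suc i) - D i + 1" using D_Suc_ge[OF i] by linarith
  moreover have "D (Suc i) - D i + 1 < D (Suc i)" using D_ge_4[OF i] less by linarith
  ultimately show ?thesis unfolding deg
    by (simp add: D_le_iff less_D_iff)
qed

section \<open>Outputs forced on the path of centres\<close>

text \<open>The ball contains \<open>D (i - 2)\<close> and \<open>D (i + 2)\<close>. An edge changes
  the layer by at most one, so a node within distance 2 of both is in layer
  \<open>i\<close>.\<close>

lemma bcentral_caterpillar:
  assumes i: "2 \<le> i" and n: "i + 2 \<le> T (n - 1)" "0 < n"
    and c: "bcentral (ball_at (caterpillar n b) out 2 (D i)) c"
  shows "c = D i"
proof -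
  let ?G = "caterpillar n b"
  let ?B = "ball_at ?G out 2 (D i)"
  have "D (i + 2) < n" using n D_le_iff[of "i + 2" "n - 1"] by linarith
  then have Dn: "D j < n" if "j \<le> i + 2" for j
    using that D_less_iff[of "i + 2" j] by linarith
  have adj_D: "adj (D j) (D (Suc j))" "adj (D (Suc j)) (D j)" for j
    by (simp_all add: adj_def T_D D_eq_iff)
  obtain j where j: "i = Suc (Suc j)" using i by (metis Suc_le_D numeral_2_eq_2 Suc_le_mono)
  have "(D i, D (i - 1)) \<in> edges ?G" "(D (i - 1), D (i - 2)) \<in> edges ?G"
    "(D i, D (i + 1)) \<in> edges ?G" "(D (i + 1), D (i + 2)) \<in> edges ?G"
    using Dn adj_D by (simp_all add: caterpillar_edges j)
  then have in_B: "D (i - 2) \<in> bverts ?B" "D (i + 2) \<in> bverts ?B"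
    by (auto simp: ball_at_def ball_verts_2)
  have path: "c = u \<or> adj c u \<or> (\<exists>w. adj c w \<and> adj w u)" if "u \<in> bverts ?B" for u
    using c that unfolding bcentral_def by (auto simp: ball_at_def caterpillar_edges)
  have "i \<le> T c"
    using path[OF in_B(2)] adj_T[of "D (i + 2)"] adj_T[of _ c] by (force simp: T_D adj_sym)
  have low: "T c \<le> i"
    using path[OF in_B(1)] adj_T[of c] adj_T[of _ "D (i - 2)"] i by (force simp: T_D)
  with \<open>i \<le> T c\<close> have Tc: "T c = i" by simp
  have "\<not> c = D (i - 2)" "\<not> adj c (D (i - 2))"
    using Tc adj_T[of c "D (i - 2)"] T_D[of "i - 2"] i by auto
  then obtain w where w: "adj c w" "adj w (D (i - 2))"
    using path[OF in_B(1)] by auto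
  \<comment> \<open>The first step from \<open>c\<close> towards \<open>D (i - 2)\<close> leaves the
    layer, and only a centre has such an edge.\<close>
  have "T w < i" using adj_T[OF w(2)] i by (simp add: T_D)
  then show ?thesis using w(1) Tc by (auto simp: adj_def)
qed

text \<open>The rule is in force at these centres, so whatever the algorithm, the bit is fixed at
  \<open>D 2\<close> by the input and copied from each centre to the next.\<close>

lemma output_caterpillar:
  assumes A: "solves Ns A (relay T)" and N: "N \<in> Ns n" "n \<le> N"
    and b: "b \<in> {0, 1}" and m: "4 \<le> T (n - 1)" "0 < n"
    and i: "2 \<le> i" "i + 2 \<le> T (n - 1)"
  shows "final_output A N (caterpillar n b) (D i) = b"
proof -
  let ?G = "caterpillar n b"
  let ?out = "final_output A N ?G"
  have inst: "(N, ?G) \<in> instances (relay T) Ns n"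
    using N b m is_network_caterpillar[of n b] unfolding instances_def
    by (auto simp: caterpillar_def relay_def)
  have v: "D j < n" if "j + 2 \<le> T (n - 1)" for j
    using that D_le_iff[of j "n - 1"] m(2) by linarith
  have bit: "?out (D j) \<in> {0, 1}"
    and rule: "?out (D j) = 1 \<longleftrightarrow> inp ?G (D j) = 1 \<or> inp ?G (D j) = 2 \<and>
        (\<exists>u. (D j, u) \<in> edges ?G \<and> Suc (T (deg ?G u)) = T (deg ?G (D j)) \<and> ?out u = 1)"
    if j: "2 \<le> j" "j + 2 \<le> T (n - 1)" for j
  proof -
    have Dj: "D j \<in> verts ?G" using v[OF j(2)] by (simp add: caterpillar_def)
    have n1: "1 \<le> n" using m by simp
    note s = A[unfolded solves_def, rule_format, OF n1 inst, simplified, rule_format, OF Dj]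
    from s show "?out (D j) \<in> {0, 1}" by (simp add: relay_def)
    have "relay_good T (ball_at ?G ?out 2 (D j))" using s by (simp add: relay_def)
    then have "relay_rule T (ball_at ?G ?out 2 (D j)) (D j)"
      unfolding relay_good_def using bcentral_ball_at bcentral_caterpillar[OF j m(2)] by blast
    then show "?out (D j) = 1 \<longleftrightarrow> inp ?G (D j) = 1 \<or> inp ?G (D j) = 2 \<and>
        (\<exists>u. (D j, u) \<in> edges ?G \<and> Suc (T (deg ?G u)) = T (deg ?G (D j)) \<and> ?out u = 1)"
      by (simp only: relay_rule_ball_at)
  qed
  show ?thesis
    using i
  proof (induction i rule: dec_induct)
    case base
    then show ?case using bit[of 2] rule[of 2] b by (auto simp: caterpillar_def)
  next
    case (step i)
    have IH: "?out (D i) = b" using step by simp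
    have i: "2 \<le> i" "Suc i + 2 \<le> T (n - 1)" using step by simp_all
    have deg: "T (deg ?G (D j)) = j" if "0 < j" "j \<le> Suc (Suc i)" for j
      using that i m by (intro deg_caterpillar) auto
    have Dn: "D i < n" "D (Suc i) < n" using v[of i] v[of "Suc i"] i by simp_all
    have inp: "inp ?G (D (Suc i)) = 2"
      using i by (simp add: caterpillar_def D_eq_iff)
    \<comment> \<open>The only predecessor is \<open>D i\<close>: the next centre has rank
      \<open>i + 2\<close>, and leaves have rank 0.\<close>
    have pred: "(D (Suc i), u) \<in> edges ?G \<and> Suc (T (deg ?G u)) = Suc i \<longleftrightarrow> u = D i" for u
    proof
      assume u: "(D (Suc i), u) \<in> edges ?G \<and> Suc (T (deg ?G u)) = Suc i"
      then have adj: "adj (D (Suc i)) u" and du: "T (deg ?G u) = i"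
        by (simp_all add: caterpillar_edges)
      from adj consider "u = D i" | "u = D (Suc (Suc i))" | "T u = Suc i" "u \<noteq> D (Suc i)"
        by (auto simp: adj_def T_D)
      then show "u = D i"
      proof cases
        case 2
        then show ?thesis using deg[of "Suc (Suc i)"] du by simp
      next
        case 3
        then have "{w. (u, w) \<in> edges ?G} \<subseteq> {D (Suc i)}"
          by (auto simp: caterpillar_edges adj_def)
        then have "deg ?G u \<le> card {D (Suc i)}" unfolding deg_def by (intro card_mono) auto
        then have "T (deg ?G u) \<le> T 3" by (intro T_le) simp
        then show ?thesis using du T_3 i by simp
      qed
    next
      assume "u = D i"
      then show "(D (Suc i), u) \<in> edges ?G \<and> Suc (T (deg ?G u)) = Suc i"
        using deg[of i] i Dn by (simp add: caterpillar_edges adj_def T_D D_eq_iff)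
    qed
    have "?out (D (Suc i)) = 1 \<longleftrightarrow> (\<exists>u. ((D (Suc i), u) \<in> edges ?G \<and>
        Suc (T (deg ?G u)) = Suc i) \<and> ?out u = 1)"
      using rule[of "Suc i"] i deg[of "Suc i"] inp by simp
    also have "\<dots> \<longleftrightarrow> ?out (D i) = 1" by (simp only: pred) simp
    finally show ?case using IH bit[of "Suc i"] i b by auto
  qed
qed

text \<open>The two networks differ only at \<open>D 2\<close>, in layer 2, and information moves by
  at most one layer per round.\<close>

lemma state_after_caterpillar:
  "t + 2 < T v \<Longrightarrow> state_after A N (caterpillar n b) t v = state_after A N (caterpillar n b') t v"
proof (induction t arbitrary: v)
  case 0
  then have "v \<noteq> D 2" by (auto simp: T_D)
  then show ?case by (simp add: caterpillar_def)
next
  case (Suc t)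
  have ports: "ports (caterpillar n b) = ports (caterpillar n b')"
    by (simp add: caterpillar_def)
  have "state_after A N (caterpillar n b) t u = state_after A N (caterpillar n b') t u"
    if "u \<in> set (ports (caterpillar n b') v)" for u
    using that adj_T[of v u] Suc.prems by (intro Suc.IH) (auto simp: caterpillar_set_ports)
  then show ?case
    using Suc by (simp add: ports port_to_def cong: map_cong)
qed

text \<open>With \<open>b\<close> equal to 0 and 1, the same node must give different outputs, so it
  cannot decide before the bit reaches it.\<close>

lemma round_complexity_ge:
  assumes A: "solves Ns A (relay T)" and N: "N \<in> Ns n" "n \<le> N"
    and m: "4 \<le> T (n - 1)"
  shows "enat (T (n - 1) - 4) \<le> round_complexity Ns A (relay T) n"
proof -
  \<comment> \<open>This is the last centre covered by \<open>output_caterpillar\<close>; its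
    distance to \<open>D 2\<close> is \<open>i - 2\<close>.\<close>
  define i where "i = T (n - 1) - 2"
  have i: "2 \<le> i" "i + 2 \<le> T (n - 1)" using m by (simp_all add: i_def)
  have n: "0 < n" using m T_le[of 0 3] T_3 by (cases n) auto
  let ?G = "caterpillar n"
  let ?v = "D i"
  have inst: "(N, ?G 0) \<in> instances (relay T) Ns n"
    using N n is_network_caterpillar[of n 0] unfolding instances_def
    by (auto simp: caterpillar_def relay_def)
  have v: "?v < n" using i D_le_iff[of i "n - 1"] n by linarith
  have late: "i \<le> t + 2" if t: "has_output A N (?G 0) ?v t" for t
  proof (rule ccontr)
    assume "\<not> i \<le> t + 2"
    then have "state_after A N (?G 0) s ?v = state_after A N (?G 1) s ?v" if "s \<le> t" for s
      using that by (intro state_after_caterpillar) (simp add: T_D)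
    then have same: "has_output A N (?G 0) ?v s = has_output A N (?G 1) ?v s"
      "state_after A N (?G 0) s ?v = state_after A N (?G 1) s ?v" if "s \<le> t" for s
      using that by (simp_all add: has_output_def)
    let ?l = "LEAST s. has_output A N (?G 0) ?v s"
    have l: "has_output A N (?G 0) ?v ?l" "?l \<le> t" using t by (auto intro: LeastI Least_le)
    have "(LEAST s. has_output A N (?G 1) ?v s) = ?l"
    proof (rule Least_equality)
      show "has_output A N (?G 1) ?v ?l" using l same by blast
      fix s assume "has_output A N (?G 1) ?v s"
      then show "?l \<le> s" using same[of s] l(2) by (cases "s \<le> t") (auto intro: Least_le)
    qed
    then have "final_output A N (?G 0) ?v = final_output A N (?G 1) ?v"
      using same(2)[OF l(2)] by (simp add: final_output_def)
    then show False
      using output_caterpillar[OF A N _ m n i, of 0] output_caterpillar[OF A N _ m n i, of 1] by simp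
  qed
  have "enat (i - 2) \<le> (INF t\<in>{t. has_output A N (?G 0) ?v t}. enat t)"
    using late by (intro INF_greatest) force
  also have "\<dots> \<le> rounds A N (?G 0)"
    unfolding rounds_def using v by (intro SUP_upper) (simp add: caterpillar_def)
  also have "\<dots> \<le> round_complexity Ns A (relay T) n"
    unfolding round_complexity_def using inst by (intro SUP_upper2[of "(N, ?G 0)"]) auto
  finally show ?thesis by (simp add: i_def)
qed

lemma relay_Theta: "problem_complexity_Theta (relay T) (\<lambda>n. real (T n))"
  unfolding problem_complexity_Theta_def
proof (intro allI impI conjI)
  fix Ns
  assume "polynomial_bounds Ns"
  then obtain c where "\<forall>n\<ge>1. Ns n \<noteq> {} \<and> Ns n \<subseteq> {n..c * n ^ c}"
    unfolding polynomial_bounds_def by blast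
  then have Ns: "\<exists>N\<in>Ns n. n \<le> N" if "1 \<le> n" for n using that by fastforce
  have "ereal_of_enat (round_complexity Ns (relay_alg T) (relay T) n) \<le> ereal (1 * real (T n))" for n
    using round_complexity_relay[OF mono, of Ns "relay T" n]
    by (metis ereal_of_enat_le_iff ereal_of_enat_simps(1) mult_1)
  then show "\<exists>A. solves Ns A (relay T) \<and>
      (\<exists>c>0. \<forall>\<^sub>F n in sequentially.
         ereal_of_enat (round_complexity Ns A (relay T) n) \<le> ereal (c * real (T n)))"
    using solves_relay by (intro exI[of _ "relay_alg T"] conjI exI[of _ "1::real"]) auto
  fix A
  assume A: "solves Ns A (relay T)"
  \<comment> \<open>The lower bound \<open>T (n - 1) - 4\<close> is at least \<open>T n - 5\<close>,
    which is at least half of \<open>T n\<close> once \<open>T n\<close> is at least 10.\<close>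
  have "ereal (1 / 2 * real (T n)) \<le> ereal_of_enat (round_complexity Ns A (relay T) n)"
    if n: "D 10 \<le> n" for n
  proof -
    have "10 \<le> T n" using n by (simp add: D_le_iff)
    then have n0: "1 \<le> n" using T_le[of 0 3] T_3 by (cases n) auto
    then have "T n \<le> Suc (T (n - 1))" using T_Suc[of "n - 1"] by simp
    with \<open>10 \<le> T n\<close> have m: "4 \<le> T (n - 1)" "1 / 2 * real (T n) \<le> real (T (n - 1) - 4)"
      by linarith+
    obtain N where "N \<in> Ns n" "n \<le> N" using Ns n0 by blast
    then have "enat (T (n - 1) - 4) \<le> round_complexity Ns A (relay T) n"
      using A m by (intro round_complexity_ge)
    then have "ereal (real (T (n - 1) - 4)) \<le> ereal_of_enat (round_complexity Ns A (relay T) n)"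
      by (metis ereal_of_enat_le_iff ereal_of_enat_simps(1))
    then show ?thesis using m(2) by (metis ereal_less_eq(3) order_trans)
  qed
  then show "\<exists>c>0. \<forall>\<^sub>F n in sequentially.
      ereal (c * real (T n)) \<le> ereal_of_enat (round_complexity Ns A (relay T) n)"
    unfolding eventually_sequentially by (intro exI[of _ "1 / 2 :: real"]) auto
qed

end

section \<open>Slowly growing complexities\<close>

lemma problem_complexity_Theta_cong:
  assumes P: "problem_complexity_Theta P f"
    and c: "0 < c1" "0 < c2"
    and fg: "\<forall>\<^sub>F n in sequentially. c1 * f n \<le> g n \<and> g n \<le> c2 * f n"
  shows "problem_complexity_Theta P g"
  unfolding problem_complexity_Theta_def
proof (intro allI impI conjI)
  fix Ns assume Ns: "polynomial_bounds Ns"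
  obtain A c where A: "solves Ns A P" "0 < c"
    "\<forall>\<^sub>F n in sequentially. ereal_of_enat (round_complexity Ns A P n) \<le> ereal (c * f n)"
    using P Ns unfolding problem_complexity_Theta_def by blast
  have "\<forall>\<^sub>F n in sequentially. ereal_of_enat (round_complexity Ns A P n) \<le> ereal (c / c1 * g n)"
    using A(3) fg
  proof eventually_elim
    case (elim n)
    have "c * f n = c / c1 * (c1 * f n)" using c by simp
    also have "\<dots> \<le> c / c1 * g n" using elim A(2) c by (intro mult_left_mono) auto
    finally show ?case using elim by (metis ereal_less_eq(3) order_trans)
  qed
  moreover have "0 < c / c1" using A(2) c by simp
  ultimately show "\<exists>A. solves Ns A P \<and> (\<exists>c>0. \<forall>\<^sub>F n in sequentially.
      ereal_of_enat (round_complexity Ns A P n) \<le> ereal (c * g n))"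
    using A(1) by blast
next
  fix Ns A assume "polynomial_bounds Ns" "solves Ns A P"
  then obtain c where A: "0 < c"
    "\<forall>\<^sub>F n in sequentially. ereal (c * f n) \<le> ereal_of_enat (round_complexity Ns A P n)"
    using P unfolding problem_complexity_Theta_def by blast
  have "\<forall>\<^sub>F n in sequentially. ereal (c / c2 * g n) \<le> ereal_of_enat (round_complexity Ns A P n)"
    using A(2) fg
  proof eventually_elim
    case (elim n)
    have "c / c2 * g n \<le> c / c2 * (c2 * f n)" using elim A(1) c by (intro mult_left_mono) auto
    also have "\<dots> = c * f n" using c by simp
    finally show ?case using elim by (metis ereal_less_eq(3) order_trans)
  qed
  moreover have "0 < c / c2" using A(1) c by simp
  ultimately show "\<exists>c>0. \<forall>\<^sub>F n in sequentially.
      ereal (c * g n) \<le> ereal_of_enat (round_complexity Ns A P n)"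
    by blast
qed

lemma ex_problem_Theta:
  fixes t :: "nat \<Rightarrow> real"
  assumes lim: "filterlim t at_top sequentially"
    and mono: "\<And>m n. a \<le> m \<Longrightarrow> m \<le> n \<Longrightarrow> t m \<le> t n"
    and exp: "\<And>n. a \<le> n \<Longrightarrow> t (2 ^ n) \<le> t n + 1"
  shows "\<exists>P. locally_checkable P \<and> problem_complexity_Theta P t"
proof -
  obtain n1 where n1: "\<forall>n\<ge>n1. 0 \<le> t n"
    using lim unfolding filterlim_at_top eventually_sequentially by blast
  define k where "k = max 3 (max a n1)"
  have k: "3 \<le> k" "a \<le> k" "0 \<le> t k" using n1 by (auto simp: k_def)
  \<comment> \<open>Rounding \<open>t\<close> down keeps growth by at most one; freezing the
    argument below \<open>k\<close> and subtracting the value there gives \<open>T 3 = 0\<close>.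
    The total change is bounded.\<close>
  define T where "T n = nat \<lfloor>t (max n k)\<rfloor> - nat \<lfloor>t k\<rfloor>" for n
  have pow: "n \<le> 2 ^ n" for n :: nat using less_exp[of n] by simp
  have bounds: "real (T n) \<le> t n" "t n - t k - 1 \<le> real (T n)" if n: "k \<le> n" for n
    using mono[OF k(2) n] k(3) n unfolding T_def by (simp_all add: max_def) linarith+
  have T_unb: "\<exists>n. j \<le> T n" for j
  proof -
    obtain m where "\<forall>n\<ge>m. real j + t k + 1 \<le> t n"
      using lim unfolding filterlim_at_top eventually_sequentially by blast
    then have "real j + t k + 1 \<le> t (max m k)" by simp
    then have "real j \<le> real (T (max m k))" using bounds(2)[OF max.cobounded2[of k m]] by linarith
    then show ?thesis by auto
  qed
  interpret slow_rank T
  proof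
    show "mono T"
      unfolding T_def using k(2)
      by (intro monoI diff_le_mono nat_mono floor_mono mono) auto
    show "T 3 = 0" using k(1) by (simp add: T_def)
    show "T (2 ^ n) \<le> Suc (T n)" for n
    proof -
      \<comment> \<open>For \<open>n\<close> below \<open>k\<close> the assumption on
        \<open>t\<close> is applied at \<open>k\<close> instead.\<close>
      have "t (max (2 ^ n) k) \<le> t (2 ^ max n k)"
      proof (rule mono)
        show "max (2 ^ n) k \<le> 2 ^ max n k"
          using order_trans[OF pow[of k] power_increasing[of k "max n k" "2::nat"]]
            power_increasing[of n "max n k" "2::nat"] by simp
      qed (use k(2) in simp)
      also have "\<dots> \<le> t (max n k) + 1" using k(2) by (intro exp) simp
      finally have "nat \<lfloor>t (max (2 ^ n) k)\<rfloor> \<le> nat \<lfloor>t (max n k) + 1\<rfloor>"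
        by (intro nat_mono floor_mono)
      then show ?thesis unfolding T_def by linarith
    qed
  qed (rule T_unb)
  have "\<forall>\<^sub>F n in sequentially. 2 * (t k + 1) \<le> t n"
    using lim unfolding filterlim_at_top by blast
  then have "\<forall>\<^sub>F n in sequentially. 1 * real (T n) \<le> t n \<and> t n \<le> 2 * real (T n)"
    using eventually_ge_at_top[of k]
  proof eventually_elim
    \<comment> \<open>The loss \<open>t k + 1\<close> in \<open>bounds\<close> is at most half of
      \<open>t n\<close>, hence the factor 2.\<close>
    case (elim n)
    then show ?case using bounds[of n] by (simp add: algebra_simps)
  qed
  then have "problem_complexity_Theta (relay T) t"
    by (intro problem_complexity_Theta_cong[OF relay_Theta, of 1 2]) auto
  then show ?thesis using locally_checkable_relay by blast
qed

section \<open>Growth of \<open>log_star\<close> and its iterates\<close>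

text \<open>Above 2 a logarithm lowers its argument by at least 1, so induction on an integer bound
  for \<open>x\<close> works.\<close>

lemma log_star_ex: "\<exists>k. (log 2 ^^ k) x \<le> 1"
proof -
  have "x \<le> real m \<Longrightarrow> \<exists>k. (log 2 ^^ k) x \<le> 1" for m
  proof (induction m arbitrary: x)
    case 0
    then show ?case by (intro exI[of _ 0]) simp
  next
    case (Suc m)
    show ?case
    proof (cases "x \<le> 2")
      case True
      show ?thesis
      proof (cases "x \<le> 1")
        case False
        then have "log 2 x \<le> 1" using True log_le_cancel_iff[of 2 x 2] by simp
        then show ?thesis by (intro exI[of _ 1]) simp
      qed (intro exI[of _ 0], simp)
    next
      case False
      \<comment> \<open>\<open>ln (x / 2) \<le> x / 2 - 1\<close> and \<open>ln 2 \<ge> 1 / 2\<close>\<close>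
      have "ln x = ln 2 + ln (x / 2)" using False by (simp add: ln_div)
      also have "ln (x / 2) \<le> x / 2 - 1" using False by (intro ln_le_minus_one) simp
      finally have "ln x - ln 2 \<le> (x - 2) * (1 / 2)" by simp
      also have "\<dots> \<le> (x - 2) * ln 2" using False ln_le_minus_one[of "1 / 2"]
        by (intro mult_left_mono) (auto simp: ln_div)
      finally have "ln x \<le> (x - 1) * ln 2" by (simp add: algebra_simps)
      then have "log 2 x \<le> x - 1" by (simp add: log_def field_simps)
      then obtain k where "(log 2 ^^ k) (log 2 x) \<le> 1"
        using Suc.IH[of "log 2 x"] Suc.prems by auto
      then show ?thesis by (intro exI[of _ "Suc k"]) (simp add: funpow_swap1)
    qed
  qed
  then show ?thesis using real_arch_simple by blast
qed

lemma log_star_le: "(log 2 ^^ k) (real n) \<le> 1 \<Longrightarrow> log_star n \<le> k"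
  unfolding log_star_def by (rule Least_le)

lemma log_star_works: "(log 2 ^^ log_star n) (real n) \<le> 1"
  unfolding log_star_def by (rule LeastI_ex) (rule log_star_ex)

lemma log_star_mono: "m \<le> n \<Longrightarrow> log_star m \<le> log_star n"
proof -
  assume "m \<le> n"
  \<comment> \<open>The index may drop to \<open>j\<close>: past the first iterate of
    \<open>x\<close> that is at most 1, logarithms of nonpositive numbers may occur, so monotonicity
    is lost.\<close>
  have "x \<le> y \<Longrightarrow> (log 2 ^^ k) y \<le> 1 \<Longrightarrow> \<exists>j\<le>k. (log 2 ^^ j) x \<le> 1" for x y k
  proof (induction k arbitrary: x y)
    case 0
    then show ?case by simp
  next
    case (Suc k)
    show ?case
    proof (cases "x \<le> 1")
      case False
      then have "log 2 x \<le> log 2 y" using Suc.prems(1) by simp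
      moreover have "(log 2 ^^ k) (log 2 y) \<le> 1"
        using Suc.prems(2) by (simp add: funpow_swap1)
      ultimately obtain j where "j \<le> k" "(log 2 ^^ j) (log 2 x) \<le> 1"
        using Suc.IH by blast
      then show ?thesis by (intro exI[of _ "Suc j"]) (simp add: funpow_swap1)
    qed (intro exI[of _ 0], simp)
  qed
  from this[of "real m" "real n" "log_star n"] \<open>m \<le> n\<close> log_star_works[of n]
  show ?thesis using log_star_le by force
qed

lemma log_funpow_exp: "(log 2 ^^ Suc k) (real (2 ^ n)) = (log 2 ^^ k) (real n)"
  by (simp add: funpow_Suc_right del: funpow.simps)

lemma log_star_exp_le: "log_star (2 ^ n) \<le> Suc (log_star n)"
  using log_star_works[of n] log_funpow_exp[of "log_star n" n] by (intro log_star_le) linarith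

text \<open>For positive \<open>n\<close>, \<open>2 ^ n\<close> exceeds 1, so at least one logarithm
  is applied, and the first one yields \<open>n\<close>.\<close>

lemma log_star_exp_ge:
  assumes "1 \<le> n"
  shows "Suc (log_star n) \<le> log_star (2 ^ n)"
proof (cases "log_star (2 ^ n)")
  case 0
  have "(2::nat) ^ 1 \<le> 2 ^ n" using assms by (intro power_increasing) auto
  then have "real 2 \<le> real (2 ^ n)" by (subst of_nat_le_iff) simp
  then show ?thesis using log_star_works[of "2 ^ n"] by (simp add: 0)
next
  case (Suc k)
  have "(log 2 ^^ k) (real n) \<le> 1"
    using log_star_works[of "2 ^ n"] log_funpow_exp[of k n] by (simp add: Suc)
  then show ?thesis using log_star_le Suc by simp
qed

lemma filterlim_log_star: "filterlim log_star at_top at_top"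
  unfolding filterlim_at_top eventually_sequentially
proof
  fix k
  have "\<exists>n\<ge>1. k \<le> log_star n"
  proof (induction k)
    case (Suc k)
    then obtain n where n: "n \<ge> 1" "k \<le> log_star n" by blast
    then have "Suc k \<le> log_star (2 ^ n)" using log_star_exp_ge[of n] by simp
    then show ?case by (intro exI[of _ "2 ^ n"]) simp
  qed auto
  then show "\<exists>N. \<forall>n\<ge>N. k \<le> log_star n" using log_star_mono order_trans by blast
qed

lemma log_star_funpow:
  fixes r :: nat
  shows "filterlim (log_star ^^ r) at_top at_top"
    and "m \<le> n \<Longrightarrow> (log_star ^^ r) m \<le> (log_star ^^ r) n"
proof (induction r arbitrary: m n)
  case (Suc r)
  { case 1 show ?case
      using filterlim_compose[OF filterlim_log_star Suc.IH(1)] by (simp add: comp_def) }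
  { case 2 then show ?case using Suc.IH(2) by (simp add: log_star_mono) }
qed (auto simp: filterlim_ident id_def)

text \<open>An increase by one is below an exponential, \<open>m + 1 \<le> 2 ^ m\<close>, so the
  next \<open>log_star\<close> again adds at most one.\<close>

lemma log_star_funpow_exp:
  assumes "1 \<le> r"
  shows "(log_star ^^ r) (2 ^ n) \<le> Suc ((log_star ^^ r) n)"
  using assms
proof (induction r rule: dec_induct)
  case base
  then show ?case by (simp add: log_star_exp_le)
next
  case (step r)
  let ?m = "(log_star ^^ r) n"
  have "(log_star ^^ r) (2 ^ n) \<le> 2 ^ ?m"
    using step.IH by (rule order_trans) (simp add: Suc_le_eq)
  then have "log_star ((log_star ^^ r) (2 ^ n)) \<le> log_star (2 ^ ?m)" by (rule log_star_mono)
  then show ?case using log_star_exp_le[of ?m] by simp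
qed

section \<open>Functions that grow by at most one per unit step\<close>

text \<open>This class is closed under composition, and applying such a function after the iterated
  \<open>log_star\<close> preserves the growth bound under \<open>n \<mapsto> 2 ^ n\<close> for
  large \<open>n\<close>.\<close>

definition slow :: "(real \<Rightarrow> real) \<Rightarrow> bool" where
  "slow g \<longleftrightarrow> filterlim g at_top at_top \<and>
     (\<exists>x0. \<forall>x y. x0 \<le> x \<longrightarrow> x \<le> y \<longrightarrow> g x \<le> g y \<and> (y \<le> x + 1 \<longrightarrow> g y \<le> g x + 1))"

lemma slow_id: "slow id"
  by (auto simp: slow_def id_def filterlim_ident)

lemma slow_comp:
  assumes g: "slow g" and h: "slow h"
  shows "slow (g \<circ> h)"
proof -
  obtain x0 x1 where
    x0: "\<And>x y. x0 \<le> x \<Longrightarrow> x \<le> y \<Longrightarrow> g x \<le> g y \<and> (y \<le> x + 1 \<longrightarrow> g y \<le> g x + 1)" and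
    x1: "\<And>x y. x1 \<le> x \<Longrightarrow> x \<le> y \<Longrightarrow> h x \<le> h y \<and> (y \<le> x + 1 \<longrightarrow> h y \<le> h x + 1)"
    using g h unfolding slow_def by metis
  obtain x2 where x2: "\<And>x. x2 \<le> x \<Longrightarrow> x0 \<le> h x"
    using h unfolding slow_def filterlim_at_top eventually_at_top_linorder by blast
  have "filterlim (\<lambda>x. g (h x)) at_top at_top"
    using g h unfolding slow_def by (blast intro: filterlim_compose)
  moreover have "(g \<circ> h) x \<le> (g \<circ> h) y \<and> (y \<le> x + 1 \<longrightarrow> (g \<circ> h) y \<le> (g \<circ> h) x + 1)"
    if "max x1 x2 \<le> x" "x \<le> y" for x y
    using that x1[of x y] x0[of "h x" "h y"] x2[of x] by simp
  ultimately show ?thesis unfolding slow_def comp_def by blast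
qed

lemma slow_log: "slow (log 2)"
proof -
  have "filterlim (\<lambda>x. log 2 x) at_top at_top"
    unfolding log_def divide_inverse_commute
    by (rule filterlim_tendsto_pos_mult_at_top[OF tendsto_const _ ln_at_top]) simp
  moreover have "log 2 x \<le> log 2 y \<and> (y \<le> x + 1 \<longrightarrow> log 2 y \<le> log 2 x + 1)"
    if "1 \<le> x" "x \<le> y" for x y :: real
  proof (intro conjI impI)
    show "log 2 x \<le> log 2 y" using that by simp
    assume "y \<le> x + 1"
    \<comment> \<open>Here \<open>x + 1 \<le> 2 * x\<close>, because \<open>x\<close> is at least
      1.\<close>
    then have "log 2 y \<le> log 2 (2 * x)" using that by simp
    also have "\<dots> = log 2 x + 1" using that by (simp add: log_mult)
    finally show "log 2 y \<le> log 2 x + 1" .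
  qed
  ultimately show ?thesis unfolding slow_def by blast
qed

lemma slow_powr:
  fixes \<epsilon> :: real
  assumes "0 < \<epsilon>" "\<epsilon> < 1"
  shows "slow (\<lambda>x. x powr \<epsilon>)"
proof -
  have "filterlim (\<lambda>x::real. x powr \<epsilon>) at_top at_top"
  proof -
    have "filterlim (\<lambda>x. exp (\<epsilon> * ln x)) at_top at_top"
      using filterlim_tendsto_pos_mult_at_top[OF tendsto_const assms(1) ln_at_top]
      by (rule filterlim_compose[OF exp_at_top])
    moreover have "\<forall>\<^sub>F x::real in at_top. exp (\<epsilon> * ln x) = x powr \<epsilon>"
      using eventually_gt_at_top[of 0] by eventually_elim (simp add: powr_def)
    ultimately show ?thesis by (rule filterlim_mono_eventually[OF _ order_refl order_refl])
  qed
  moreover have "x powr \<epsilon> \<le> y powr \<epsilon> \<and> (y \<le> x + 1 \<longrightarrow> y powr \<epsilon> \<le> x powr \<epsilon> + 1)"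
    if "1 \<le> x" "x \<le> y" for x y :: real
  proof (intro conjI impI)
    show "x powr \<epsilon> \<le> y powr \<epsilon>" using that assms by (intro powr_mono2) auto
    assume "y \<le> x + 1"
    \<comment> \<open>Splitting off one factor leaves the negative exponent
      \<open>\<epsilon> - 1\<close>, for which the power is decreasing and at most 1 beyond
      1.\<close>
    have split: "z powr \<epsilon> = z * z powr (\<epsilon> - 1)" if "1 \<le> z" for z :: real
      using that powr_add[of z 1 "\<epsilon> - 1"] by simp
    have "y powr \<epsilon> = y * y powr (\<epsilon> - 1)" using that by (intro split) simp
    also have "\<dots> \<le> (x + 1) * y powr (\<epsilon> - 1)"
      using \<open>y \<le> x + 1\<close> by (intro mult_right_mono) auto
    also have "\<dots> = x * y powr (\<epsilon> - 1) + y powr (\<epsilon> - 1)" by (simp add: algebra_simps)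
    also have "\<dots> \<le> x * x powr (\<epsilon> - 1) + 1 powr (\<epsilon> - 1)"
      using that assms by (intro add_mono mult_left_mono powr_mono2') auto
    also have "\<dots> = x powr \<epsilon> + 1" using split[of x] that by simp
    finally show "y powr \<epsilon> \<le> x powr \<epsilon> + 1" .
  qed
  ultimately show ?thesis unfolding slow_def by blast
qed

lemma ex_problem_slow_log_star:
  assumes g: "slow g" and r: "1 \<le> r"
  shows "\<exists>P. locally_checkable P \<and>
     problem_complexity_Theta P (\<lambda>n. g (real ((log_star ^^ r) n)))"
proof -
  let ?M = "log_star ^^ r"
  obtain x0 where x0: "\<And>x y. x0 \<le> x \<Longrightarrow> x \<le> y \<Longrightarrow> g x \<le> g y \<and> (y \<le> x + 1 \<longrightarrow> g y \<le> g x + 1)"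
    using g unfolding slow_def by metis
  have lim: "filterlim (\<lambda>n. real (?M n)) at_top sequentially"
    using filterlim_compose[OF filterlim_real_sequentially log_star_funpow(1)] .
  then obtain n0 where n0: "\<And>n. n0 \<le> n \<Longrightarrow> x0 \<le> real (?M n)"
    unfolding filterlim_at_top eventually_sequentially by blast
  have le: "real (?M m) \<le> real (?M n)" if "m \<le> n" for m n
    using log_star_funpow(2)[OF that] by simp
  show ?thesis
  proof (rule ex_problem_Theta[where a = n0])
    show "filterlim (\<lambda>n. g (real (?M n))) at_top sequentially"
      using g lim filterlim_compose[of g at_top at_top] unfolding slow_def by blast
    show "g (real (?M m)) \<le> g (real (?M n))" if "n0 \<le> m" "m \<le> n" for m n
      using x0[OF n0[OF that(1)] le[OF that(2)]] by blast
    show "g (real (?M (2 ^ n))) \<le> g (real (?M n)) + 1" if "n0 \<le> n" for n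
    proof -
      have "real (?M n) \<le> real (?M (2 ^ n))" using less_exp[of n] by (intro le) simp
      moreover have "real (?M (2 ^ n)) \<le> real (?M n) + 1"
        using log_star_funpow_exp[OF r, of n] by linarith
      ultimately show ?thesis using x0[OF n0[OF that]] by blast
    qed
  qed
qed

theorem corollary15:
  fixes r :: nat
  assumes "r \<ge> 1"
  shows "(\<exists>P. locally_checkable P \<and>
            problem_complexity_Theta P (\<lambda>n. real ((log_star ^^ r) n))) \<and>
         (\<forall>\<epsilon>::real. 0 < \<epsilon> \<and> \<epsilon> < 1 \<longrightarrow>
            (\<exists>P. locally_checkable P \<and>
               problem_complexity_Theta P (\<lambda>n. log 2 (real ((log_star ^^ r) n)) powr \<epsilon>))) \<and>
         (\<forall>k::nat. k \<ge> 1 \<longrightarrow>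
            (\<exists>P. locally_checkable P \<and>
               problem_complexity_Theta P (\<lambda>n. (log 2 ^^ k) (real ((log_star ^^ r) n)))))"
proof (intro conjI allI impI)
  show "\<exists>P. locally_checkable P \<and> problem_complexity_Theta P (\<lambda>n. real ((log_star ^^ r) n))"
    using ex_problem_slow_log_star[OF slow_id assms] by simp
next
  fix \<epsilon> :: real assume "0 < \<epsilon> \<and> \<epsilon> < 1"
  then have "slow ((\<lambda>x. x powr \<epsilon>) \<circ> log 2)" by (intro slow_comp slow_log slow_powr) auto
  from ex_problem_slow_log_star[OF this assms]
  show "\<exists>P. locally_checkable P \<and>
      problem_complexity_Theta P (\<lambda>n. log 2 (real ((log_star ^^ r) n)) powr \<epsilon>)"
    by simp
next
  fix k :: nat
  have "slow (log 2 ^^ k)"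
  proof (induction k)
    case (Suc k)
    then show ?case unfolding funpow.simps by (rule slow_comp[OF slow_log])
  qed (use slow_id in \<open>simp add: id_def\<close>)
  from ex_problem_slow_log_star[OF this assms]
  show "\<exists>P. locally_checkable P \<and>
      problem_complexity_Theta P (\<lambda>n. (log 2 ^^ k) (real ((log_star ^^ r) n)))" .
qed

end
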